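(* Let $k\geq 2$ be a positive integer, and let $\lambda$ be a partition of $k$ such that $\lambda_1\leq\lceil k/2\rceil$ and $\lambda_i=1$ for all $1<i\leq\ell(\lambda)$. Then $\pi(\Delta_\lambda)=k!/k^k$.
   Context: A $k$-graph is a finite $k$-uniform hypergraph. For a $k$-graph $F$, $\mathrm{ex}(n,F)$ is the maximum number of edges of a $k$-graph on $n$ vertices that contains no (not necessarily induced) subgraph isomorphic to $F$, and the Turán density is $\pi(F)=\lim_{n\to\infty}\mathrm{ex}(n,F)/\binom nk$. A partition $\lambda=(\lambda_1,\ldots,\lambda_\ell)$ of $k$ is a sequence of positive integers $\lambda_1\geq\cdots\geq\lambda_\ell$ with $|\lambda|=\sum_i\lambda_i=k$; its length is $\ell(\lambda)=\ell$. For a partition $\lambda$ of $k$ with $\ell=\ell(\lambda)\geq2$, the $\lambda$-tent $\Delta_\lambda$ is the $k$-graph (unique up to isomorphism) whose edges are $e,e_1,\ldots,e_\ell$ (each of size $k$) and whose vertices are exactly those lying in these edges, with a distinguished vertex $v\notin e$, such that: $v\in e_i$ and $|e_i\cap e|=\lambda_i$ for every $i\in\{1,\ldots,\ell\}$, and $e_i\cap e_j=\{v\}$ for all $i\neq j$. The edge $e$ is called the base and $v$ the apex. *)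

theory Defs
  imports Complex_Main
begin

record 'a hypergraph =
  verts :: "'a set"
  edges :: "'a set set"

definition kgraph :: "nat \<Rightarrow> 'a hypergraph \<Rightarrow> bool" where
  "kgraph k G \<longleftrightarrow> finite (verts G) \<and> (\<forall>e\<in>edges G. e \<subseteq> verts G \<and> card e = k)"

text \<open>Subgraphs are not required to be induced.\<close>

definition subgraph :: "'a hypergraph \<Rightarrow> 'a hypergraph \<Rightarrow> bool" where
  "subgraph H G \<longleftrightarrow> verts H \<subseteq> verts G \<and> edges H \<subseteq> edges G \<and> (\<forall>e\<in>edges H. e \<subseteq> verts H)"

definition isomorphic :: "'a hypergraph \<Rightarrow> 'b hypergraph \<Rightarrow> bool" where
  "isomorphic F H \<longleftrightarrow>
     (\<exists>f. bij_betw f (verts F) (verts H) \<and> edges H = (\<lambda>e. f ` e) ` edges F)"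

definition contains_copy :: "'b hypergraph \<Rightarrow> 'a hypergraph \<Rightarrow> bool" where
  "contains_copy G F \<longleftrightarrow> (\<exists>H. subgraph H G \<and> isomorphic F H)"

text \<open>
  The host graphs have vertices in \<^typ>\<open>nat\<close>, which is no restriction up to isomorphism.
  The set below is finite for every \<^term>\<open>n\<close>, and it is nonempty if \<^term>\<open>F\<close> has an edge.
\<close>

definition ex_turan :: "nat \<Rightarrow> nat \<Rightarrow> 'a hypergraph \<Rightarrow> nat" where
  "ex_turan k n F =
     Max {card (edges G) | G :: nat hypergraph.
            kgraph k G \<and> card (verts G) = n \<and> \<not> contains_copy G F}"

definition turan_density :: "nat \<Rightarrow> 'a hypergraph \<Rightarrow> real" where
  "turan_density k F = lim (\<lambda>n. real (ex_turan k n F) / real (n choose k))"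

definition is_partition :: "nat \<Rightarrow> nat list \<Rightarrow> bool" where
  "is_partition k lam \<longleftrightarrow> (\<forall>x\<in>set lam. 0 < x) \<and> sorted_wrt (\<ge>) lam \<and> sum_list lam = k"

text \<open>
  The parts of the partition and the non-base edges are indexed from 0.  The tent is
  determined by \<^term>\<open>lam\<close> only up to isomorphism, hence a predicate.
\<close>

definition is_tent :: "nat list \<Rightarrow> 'a hypergraph \<Rightarrow> bool" where
  "is_tent lam F \<longleftrightarrow>
     length lam \<ge> 2 \<and> kgraph (sum_list lam) F \<and>
     (\<exists>b es v.
        edges F = insert b (es ` {..<length lam}) \<and>
        verts F = \<Union> (edges F) \<and>
        v \<notin> b \<and>
        (\<forall>i<length lam. v \<in> es i \<and> card (es i \<inter> b) = lam ! i) \<and>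
        (\<forall>i<length lam. \<forall>j<length lam. i \<noteq> j \<longrightarrow> es i \<inter> es j = {v}))"

lemma is_tent_exists:
  assumes part: "is_partition k lam" and len: "length lam \<ge> 2"
  shows "\<exists>F :: (nat \<times> nat) hypergraph. is_tent lam F"
proof -
  define l where "l = length lam"
  define b where "b = (SIGMA i:{..<l}. {..<lam ! i})"
  define es where "es = (\<lambda>i. insert (l, 0::nat) ({i} \<times> {..<k - 1}))"
  define E where "E = insert b (es ` {..<l})"
  define F where "F = \<lparr>verts = \<Union>E, edges = E\<rparr>"
  have k: "sum_list lam = k" using part by (simp add: is_partition_def)
  have sumk: "(\<Sum>i<l. lam ! i) = k"
    using k by (simp add: sum_list_sum_nth l_def atLeast0LessThan)
  have le: "lam ! i \<le> k - 1" if "i < l" for i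
  proof -
    define j where "j = (if i = 0 then 1 else 0 :: nat)"
    have j: "j < l" "j \<noteq> i"
      using len by (auto simp: j_def l_def)
    have "0 < lam ! j" using part j by (simp add: is_partition_def l_def)
    moreover have "lam ! i + lam ! j = (\<Sum>m\<in>{i,j}. lam ! m)" using j by simp
    moreover have "\<dots> \<le> (\<Sum>m<l. lam ! m)"
      by (rule sum_mono2) (use j \<open>i < l\<close> in auto)
    ultimately show ?thesis using sumk by linarith
  qed
  have kpos: "k \<ge> 1"
  proof -
    have "lam ! 0 \<in> set lam" using len by (intro nth_mem) auto
    then show ?thesis
      using part member_le_sum_list[of "lam ! 0" lam] k by (fastforce simp: is_partition_def)
  qed
  have cb: "card b = k" using sumk by (simp add: b_def)
  have ces: "card (es i) = k" if "i < l" for i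
    using that kpos by (simp add: es_def card_cartesian_product card_insert_if)
  have fin: "finite b" "finite (es i)" for i by (auto simp: b_def es_def)
  have int: "card (es i \<inter> b) = lam ! i" if "i < l" for i
  proof -
    have "es i \<inter> b = {i} \<times> {..<lam ! i}"
      using that le[OF that] by (auto simp: es_def b_def)
    then show ?thesis by (simp add: card_cartesian_product)
  qed
  have kg: "kgraph k F"
    unfolding kgraph_def F_def E_def using fin cb ces by auto
  have "is_tent lam F"
    unfolding is_tent_def k
  proof (intro conjI exI[of _ b] exI[of _ es] exI[of _ "(l, 0)"])
    show "edges F = insert b (es ` {..<length lam})" by (simp add: F_def E_def l_def)
    show "(l, 0) \<notin> b" by (simp add: b_def)
    show "\<forall>i<length lam. (l, 0) \<in> es i \<and> card (es i \<inter> b) = lam ! i"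
      using int by (simp add: l_def es_def)
    show "\<forall>i<length lam. \<forall>j<length lam. i \<noteq> j \<longrightarrow> es i \<inter> es j = {(l, 0)}"
      by (auto simp: es_def)
  qed (use len kg in \<open>simp_all add: F_def\<close>)
  then show ?thesis by blast
qed

end

theory Submission
  imports Defs "HOL-Combinatorics.Multiset_Permutations"
begin

text \<open>
  Lower bound: colour the vertices with \<open>k\<close> colours in classes of almost equal size and take all
  \<open>k\<close>-sets with one vertex of each colour.  There are about \<open>(n/k)^k\<close> of them.  A tent would have a
  base vertex of the same colour as its apex, and these two lie in a common edge.

  Upper bound: let \<open>E\<close> be the edges of a tent-free \<open>k\<close>-graph on \<open>n\<close> vertices.  Deleting
  \<open>O(n^(k-1))\<close> edges makes \<open>E\<close> flexible: a subset of an edge can be extended to an edge that avoids any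
  prescribed boundedly many other vertices (\<open>exists_flexible_subset\<close>).  Now let \<open>S \<union> T\<close> be an edge and
  let \<open>v\<close> be a vertex outside it such that \<open>insert v S\<close> and \<open>insert v T\<close> each lie in an edge, where
  \<open>card S \<ge> k/2\<close>.  Then \<open>S\<close> has room for the large part of the partition, every other vertex of the
  edge lies together with \<open>v\<close> in some edge, and flexibility turns these edges into the arms of a tent
  (\<open>flexible_attach_edges\<close>, \<open>contains_copy_tentI\<close>).  So this configuration is absent.

  Without it there are at most \<open>(n/k)^k\<close> edges, by an entropy argument
  (\<open>symmetric_tuples.card_le\<close>, \<open>card_uniform_le_if_no_cover\<close>).  Let \<open>(X_1, ..., X_k)\<close> be a uniformly random
  ordered edge and let \<open>y_m\<close> be the exponential of the conditional entropy of one coordinate given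
  \<open>k - m\<close> others, the effective number of choices for a coordinate when \<open>m\<close> are still to be chosen.
  By the chain rule, \<open>y_1 * ... * y_k\<close> is the number \<open>k! * card E\<close> of ordered edges, and \<open>y_k \<le> n\<close>.

  The point is that \<open>y_a + y_b \<le> y_(a+b)\<close>.  Split an edge as \<open>W \<union> A \<union> B\<close> with \<open>card A = b\<close> and
  \<open>card B = a\<close>, and resample one vertex given \<open>W \<union> A\<close>, and another one given \<open>W \<union> B\<close>.  A vertex that is
  possible for both would complete the forbidden configuration, so the two conditional laws have
  disjoint supports.  Without conditioning on \<open>A\<close> and \<open>B\<close>, each of the two vertices has the law of a
  new vertex given \<open>W\<close> alone, whose effective number of choices is \<open>y_(a+b)\<close>; this law must
  accommodate both disjoint supports, with \<open>y_a\<close> and \<open>y_b\<close> effective choices.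

  A superadditive sequence satisfies \<open>y_1/1 + y_2/2 + ... + y_k/k \<le> y_k\<close>, so the inequality of the
  arithmetic and geometric means bounds the product of the \<open>y_m / m\<close>, which is \<open>card E\<close>, by
  \<open>(y_k/k)^k \<le> (n/k)^k\<close>.
\<close>

section \<open>Superadditive sequences\<close>

text \<open>
  Jensen's inequality for the exponential function: compare it with its tangent at the mean.
\<close>

lemma exp_mean_le:
  fixes p x :: "'b \<Rightarrow> real"
  assumes "finite S" and "\<And>i. i \<in> S \<Longrightarrow> p i \<ge> 0" and "(\<Sum>i\<in>S. p i) = 1"
  shows "exp (\<Sum>i\<in>S. p i * x i) \<le> (\<Sum>i\<in>S. p i * exp (x i))"
proof -
  define m where "m = (\<Sum>i\<in>S. p i * x i)"
  have tangent: "exp m * (1 + (x i - m)) \<le> exp (x i)" for i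
  proof -
    have "exp m * (1 + (x i - m)) \<le> exp m * exp (x i - m)"
      by (intro mult_left_mono exp_ge_add_one_self) auto
    then show ?thesis by (simp add: exp_add [symmetric])
  qed
  have "exp m = exp m * ((1 - m) * (\<Sum>i\<in>S. p i) + (\<Sum>i\<in>S. p i * x i))"
    by (simp add: assms(3) m_def)
  also have "\<dots> = (\<Sum>i\<in>S. p i * (exp m * (1 + (x i - m))))"
    by (simp add: sum_distrib_left sum.distrib [symmetric] algebra_simps)
  also have "\<dots> \<le> (\<Sum>i\<in>S. p i * exp (x i))"
    by (intro sum_mono mult_left_mono tangent assms)
  finally show ?thesis by (simp add: m_def)
qed

lemma prod_le_mean_power:
  fixes z :: "'b \<Rightarrow> real"
  assumes "finite S" and "S \<noteq> {}" and pos: "\<And>i. i \<in> S \<Longrightarrow> z i > 0"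
  shows "(\<Prod>i\<in>S. z i) \<le> ((\<Sum>i\<in>S. z i) / card S) ^ card S"
proof -
  let ?c = "real (card S)"
  have c: "?c > 0" using assms by (simp add: card_gt_0_iff)
  have "exp (\<Sum>i\<in>S. 1 / ?c * ln (z i)) \<le> (\<Sum>i\<in>S. 1 / ?c * exp (ln (z i)))"
    using assms c by (intro exp_mean_le) auto
  also have "\<dots> = (\<Sum>i\<in>S. z i) / ?c"
    using pos by (simp add: sum_divide_distrib)
  finally have "exp (\<Sum>i\<in>S. 1 / ?c * ln (z i)) ^ card S \<le> ((\<Sum>i\<in>S. z i) / ?c) ^ card S"
    by (intro power_mono) auto
  moreover have "exp (\<Sum>i\<in>S. 1 / ?c * ln (z i)) ^ card S = (\<Prod>i\<in>S. z i)"
  proof -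
    have "exp (\<Sum>i\<in>S. 1 / ?c * ln (z i)) ^ card S = exp (?c * (\<Sum>i\<in>S. 1 / ?c * ln (z i)))"
      by (simp add: exp_of_nat_mult)
    also have "?c * (\<Sum>i\<in>S. 1 / ?c * ln (z i)) = (\<Sum>i\<in>S. ln (z i))"
      using c by (simp add: sum_distrib_left)
    also have "exp \<dots> = (\<Prod>i\<in>S. z i)"
      using assms(1) pos by (simp add: exp_sum)
    finally show ?thesis .
  qed
  ultimately show ?thesis by simp
qed

text \<open>
  Strong induction.  Summing the claims for all \<open>j < n\<close> gives
  \<open>n * (y 1/1 + ... + y (n-1)/(n-1)) \<le> 2 * (y 1 + ... + y (n-1))\<close>, and the right-hand side is at most
  \<open>(n - 1) * y n\<close> because the terms pair up as \<open>y i + y (n - i)\<close>.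
\<close>

lemma superadditive_sum_le:
  fixes y :: "nat \<Rightarrow> real"
  assumes super: "\<And>a b. a \<ge> 1 \<Longrightarrow> b \<ge> 1 \<Longrightarrow> a + b \<le> k \<Longrightarrow> y a + y b \<le> y (a + b)"
    and "n \<ge> 1" and "n \<le> k"
  shows "(\<Sum>i=1..n. y i / i) \<le> y n"
  using assms(2,3)
proof (induction n rule: less_induct)
  case (less n)
  let ?S = "\<lambda>n. \<Sum>i=1..n. y i / i"
  have double: "(\<Sum>j=1..<m. ?S j) = m * (\<Sum>i=1..<m. y i / i) - (\<Sum>i=1..<m. y i)" if "m \<ge> 1" for m
    using that
  proof (induction m rule: dec_induct)
    case (step m)
    have "{1..m} = insert m {1..<m}" using step by auto
    moreover obtain t where "y m = real m * t" using step by (auto intro: that [of "y m / real m"])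
    ultimately have "?S m = (\<Sum>i=1..<m. y i / i) + t" "y m = real m * t" using step by simp_all
    then show ?case using step by (simp add: algebra_simps)
  qed simp
  have "(\<Sum>j=1..<n. ?S j) \<le> (\<Sum>j=1..<n. y j)"
    using less by (intro sum_mono) auto
  then have "n * (\<Sum>i=1..<n. y i / i) \<le> (\<Sum>i=1..<n. y i) + (\<Sum>i=1..<n. y i)"
    using double [OF less.prems(1)] by simp
  moreover have "(\<Sum>i=1..<n. y i) = (\<Sum>i=1..<n. y (n - i))"
    by (rule sum.reindex_bij_witness [of _ "\<lambda>i. n - i" "\<lambda>i. n - i"]) auto
  ultimately have "n * (\<Sum>i=1..<n. y i / i) \<le> (\<Sum>i=1..<n. y i + y (n - i))"
    by (simp add: sum.distrib)
  also have "\<dots> \<le> (\<Sum>i=1..<n. y n)"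
  proof (rule sum_mono)
    fix i assume "i \<in> {1..<n}"
    then show "y i + y (n - i) \<le> y n"
      using super [of i "n - i"] less.prems by auto
  qed
  also have "\<dots> = (real n - 1) * y n" using less.prems by (simp add: of_nat_diff)
  finally have "(\<Sum>i=1..<n. y i / i) \<le> (real n - 1) * y n / n"
    using less.prems by (simp add: field_simps)
  moreover have "{1..n} = insert n {1..<n}" using less.prems by auto
  ultimately have "?S n \<le> (real n - 1) * y n / n + y n / n" by simp
  also have "\<dots> = y n" using less.prems by (simp add: field_simps)
  finally show ?case .
qed

lemma superadditive_prod_le:
  fixes y :: "nat \<Rightarrow> real"
  assumes "k \<ge> 1"
    and super: "\<And>a b. a \<ge> 1 \<Longrightarrow> b \<ge> 1 \<Longrightarrow> a + b \<le> k \<Longrightarrow> y a + y b \<le> y (a + b)"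
    and pos: "\<And>i. y i > 0"
  shows "(\<Prod>i=1..k. y i) \<le> fact k * (y k / k) ^ k"
proof -
  have "(\<Prod>i=1..k. y i) = fact k * (\<Prod>i=1..k. y i / i)"
    by (simp add: prod_dividef fact_prod)
  also have "(\<Prod>i=1..k. y i / i) \<le> ((\<Sum>i=1..k. y i / i) / card {1..k}) ^ card {1..k}"
    using assms by (intro prod_le_mean_power) auto
  also have "\<dots> \<le> (y k / k) ^ k"
    using superadditive_sum_le [OF super, of k k] assms less_imp_le [OF pos]
    by (auto intro!: power_mono divide_right_mono divide_nonneg_nonneg sum_nonneg)
  finally show ?thesis by simp
qed

section \<open>Entropy of a symmetric set of tuples\<close>

text \<open>
  A uniformly random element \<open>(X_1, ..., X_k)\<close> of \<open>Om\<close> is an exchangeable random tuple.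
  Its entropies are all expressed by the number \<open>ext ys\<close> of ways to complete a prefix \<open>ys\<close>:
  the prefix has probability \<open>ext ys / card Om\<close>, and the next entry \<open>v\<close> has
  conditional probability \<open>ext (ys @ [v]) / ext ys\<close>.
\<close>

locale symmetric_tuples =
  fixes k :: nat and Om :: "'b list set"
  assumes fin: "finite Om" and nonempty: "Om \<noteq> {}"
    and len: "xs \<in> Om \<Longrightarrow> length xs = k"
    and perm: "xs \<in> Om \<Longrightarrow> mset ys = mset xs \<Longrightarrow> ys \<in> Om"
begin

definition letters :: "'b set" where "letters = \<Union> (set ` Om)"

definition ext :: "'b list \<Rightarrow> real" where "ext ys = card {zs. ys @ zs \<in> Om}"

lemma finite_letters: "finite letters"
  unfolding letters_def using fin by auto

lemma finite_exts: "finite {zs. ys @ zs \<in> Om}"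
  using fin by (rule finite_inverse_image [of Om "\<lambda>zs. ys @ zs", simplified vimage_def]) (auto simp: inj_on_def)

lemma ext_nonneg: "ext ys \<ge> 0"
  by (simp add: ext_def)

lemma ext_pos_iff: "ext ys > 0 \<longleftrightarrow> (\<exists>zs. ys @ zs \<in> Om)"
  using finite_exts [of ys] by (auto simp: ext_def card_gt_0_iff)

lemma ext_Nil: "ext [] = card Om"
  by (simp add: ext_def)

lemma ext_full: "xs \<in> Om \<Longrightarrow> ext xs = 1"
proof -
  assume "xs \<in> Om"
  then have "{zs. xs @ zs \<in> Om} = {[]}" using len [of xs] len [of "xs @ zs" for zs] by fastforce
  then show ?thesis by (simp add: ext_def)
qed

lemma ext_take_pos: "xs \<in> Om \<Longrightarrow> ext (take j xs) > 0"
  unfolding ext_pos_iff by (metis append_take_drop_id)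

lemma card_Om_pos: "real (card Om) > 0"
  using fin nonempty by (simp add: card_gt_0_iff)

lemma ext_eq_card: "j = length ys \<Longrightarrow> ext ys = card {xs \<in> Om. take j xs = ys}"
proof -
  assume "j = length ys"
  then have "{xs \<in> Om. take j xs = ys} = (@) ys ` {zs. ys @ zs \<in> Om}"
    by (auto simp: image_iff) (metis append_take_drop_id)
  then show ?thesis by (simp add: ext_def card_image inj_on_def)
qed

lemma ext_snoc_eq_card:
  assumes "j = length ys" "j < k"
  shows "ext (ys @ [v]) = card {xs \<in> Om. take j xs = ys \<and> xs ! j = v}"
proof -
  have "(take (Suc j) xs = ys @ [v]) = (take j xs = ys \<and> xs ! j = v)" if "xs \<in> Om" for xs
    using that assms len [OF that] by (simp add: take_Suc_conv_app_nth)
  then have "{xs \<in> Om. take (Suc j) xs = ys @ [v]} = {xs \<in> Om. take j xs = ys \<and> xs ! j = v}"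
    by auto
  then show ?thesis using ext_eq_card [of "Suc j" "ys @ [v]"] assms by simp
qed

lemma sum_ext_snoc:
  assumes "length ys < k"
  shows "(\<Sum>v\<in>letters. ext (ys @ [v])) = ext ys"
proof -
  let ?j = "length ys" and ?X = "{xs \<in> Om. take (length ys) xs = ys}"
  have "real (card ?X) = (\<Sum>xs\<in>?X. 1)" by simp
  also have "\<dots> = (\<Sum>v\<in>letters. \<Sum>xs\<in>{xs \<in> ?X. xs ! ?j = v}. 1)"
    using fin finite_letters assms len by (intro sum.group [symmetric]) (auto simp: letters_def)
  also have "\<dots> = (\<Sum>v\<in>letters. ext (ys @ [v]))"
    using assms by (intro sum.cong) (auto simp: ext_snoc_eq_card conj_assoc)
  finally show ?thesis by (simp add: ext_eq_card)
qed

text \<open>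
  Drawing the tuple and then redrawing its entry \<open>j\<close> from the conditional law given the
  entries before it does not change the joint law of that prefix and that entry.
\<close>

lemma resample:
  assumes "j < k"
  shows "(\<Sum>xs\<in>Om. \<Sum>v\<in>letters. ext (take j xs @ [v]) / ext (take j xs) * g (take j xs) v)
       = (\<Sum>xs\<in>Om. g (take j xs) (xs ! j))"
proof -
  let ?T = "take j ` Om"
  have lenT: "length ys = j" if "ys \<in> ?T" for ys using that assms len by auto
  let ?h = "\<lambda>ys. \<Sum>v\<in>letters. ext (ys @ [v]) / ext ys * g ys v"
  have "(\<Sum>xs\<in>Om. ?h (take j xs)) = (\<Sum>ys\<in>?T. \<Sum>xs\<in>{xs \<in> Om. take j xs = ys}. ?h (take j xs))"
    by (rule sum.image_gen [OF fin])
  also have "\<dots> = (\<Sum>ys\<in>?T. \<Sum>xs\<in>{xs \<in> Om. take j xs = ys}. ?h ys)"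
    by (rule sum.cong [OF refl], rule sum.cong [OF refl]) simp
  also have "\<dots> = (\<Sum>ys\<in>?T. ext ys * (\<Sum>v\<in>letters. ext (ys @ [v]) / ext ys * g ys v))"
    by (rule sum.cong [OF refl]) (simp add: ext_eq_card [OF lenT [symmetric]])
  also have "\<dots> = (\<Sum>ys\<in>?T. \<Sum>v\<in>letters. ext (ys @ [v]) * g ys v)"
  proof (rule sum.cong)
    fix ys assume "ys \<in> ?T"
    then have "ext ys > 0" using ext_take_pos by auto
    then show "ext ys * (\<Sum>v\<in>letters. ext (ys @ [v]) / ext ys * g ys v) = (\<Sum>v\<in>letters. ext (ys @ [v]) * g ys v)"
      by (simp add: sum_distrib_left)
  qed simp
  also have "\<dots> = (\<Sum>(ys, v)\<in>?T \<times> letters. ext (ys @ [v]) * g ys v)"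
    by (simp add: sum.cartesian_product)
  also have "\<dots> = (\<Sum>p\<in>?T \<times> letters. \<Sum>xs\<in>{xs \<in> Om. (take j xs, xs ! j) = p}. g (take j xs) (xs ! j))"
  proof (rule sum.cong [OF refl], clarify)
    fix zs v assume "zs \<in> Om"
    let ?X = "{xs \<in> Om. (take j xs, xs ! j) = (take j zs, v)}"
    have "(\<Sum>xs\<in>?X. g (take j xs) (xs ! j)) = (\<Sum>xs\<in>?X. g (take j zs) v)"
      by (rule sum.cong) auto
    also have "\<dots> = ext (take j zs @ [v]) * g (take j zs) v"
      using assms len [OF \<open>zs \<in> Om\<close>] ext_snoc_eq_card [of j "take j zs" v] by simp
    finally show "ext (take j zs @ [v]) * g (take j zs) v = (\<Sum>xs\<in>?X. g (take j xs) (xs ! j))" ..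
  qed
  also have "\<dots> = (\<Sum>xs\<in>Om. g (take j xs) (xs ! j))"
    using fin finite_letters assms len by (intro sum.group) (auto simp: letters_def)
  finally show ?thesis .
qed

text \<open>
  The map \<open>W @ P @ Q @ R \<mapsto> W @ Q @ P @ R\<close> in terms of the block lengths, so that sums over \<open>Om\<close> can
  be reindexed by it.
\<close>

definition block_swap :: "nat \<Rightarrow> nat \<Rightarrow> nat \<Rightarrow> 'b list \<Rightarrow> 'b list" where
  "block_swap w p q xs =
     take w xs @ take q (drop (w + p) xs) @ take p (drop w xs) @ drop (w + p + q) xs"

lemma block_swap_append:
  "length W = w \<Longrightarrow> length P = p \<Longrightarrow> length Q = q \<Longrightarrow>
     block_swap w p q (W @ P @ Q @ R) = W @ Q @ P @ R"
  by (simp add: block_swap_def)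

lemma split4:
  assumes "xs \<in> Om" "w + p + q \<le> k"
  obtains W P Q R where "xs = W @ P @ Q @ R" "length W = w" "length P = p" "length Q = q"
proof (rule that)
  show "xs = take w xs @ take p (drop w xs) @ take q (drop (w + p) xs) @ drop (w + p + q) xs"
    by (metis add.commute append_take_drop_id drop_drop)
qed (use assms len in auto)

lemma sum_block_swap:
  assumes "w + p + q \<le> k"
  shows "(\<Sum>xs\<in>Om. f (block_swap w p q xs)) = (\<Sum>xs\<in>Om. f xs)"
proof -
  have inv: "block_swap w q p (block_swap w p q xs) = xs \<and> block_swap w p q xs \<in> Om"
    if pq: "w + p + q \<le> k" and xs: "xs \<in> Om" for xs p q
  proof -
    obtain W P Q R where s: "xs = W @ P @ Q @ R" "length W = w" "length P = p" "length Q = q"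
      by (rule split4 [OF xs pq])
    have "W @ Q @ P @ R \<in> Om" using xs by (rule perm) (simp add: s)
    then show ?thesis using s by (simp add: block_swap_append)
  qed
  show ?thesis
    by (rule sum.reindex_bij_witness [of _ "block_swap w q p" "block_swap w p q"])
      (use inv assms in \<open>auto simp: add_ac\<close>)
qed

text \<open>
  Up to the additive constant \<open>ln (card Om)\<close>, this is minus the entropy of \<open>(X_1, ..., X_j)\<close>.
\<close>

definition mean_ln :: "nat \<Rightarrow> real" where
  "mean_ln j = (\<Sum>xs\<in>Om. ln (ext (take j xs))) / card Om"

text \<open>
  The exponential of the conditional entropy of one entry given \<open>k - m\<close> others.
\<close>

definition eff :: "nat \<Rightarrow> real" where
  "eff m = exp (mean_ln (k - m) - mean_ln (Suc (k - m)))"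

text \<open>
  The chain rule for entropy, as a telescoping product.
\<close>

lemma prod_eff: "(\<Prod>m=1..k. eff m) = card Om"
proof -
  have "(\<Prod>m=1..k. eff m) = exp (\<Sum>m=1..k. mean_ln (k - m) - mean_ln (Suc (k - m)))"
    by (simp add: eff_def exp_sum)
  also have "(\<Sum>m=1..k. mean_ln (k - m) - mean_ln (Suc (k - m))) = (\<Sum>j<k. mean_ln j - mean_ln (Suc j))"
    by (rule sum.reindex_bij_witness [of _ "\<lambda>j. k - j" "\<lambda>m. k - m"]) auto
  also have "\<dots> = mean_ln 0 - mean_ln k"
    by (induction k) auto
  also have "mean_ln k = 0"
    using len by (simp add: mean_ln_def ext_full)
  also have "mean_ln 0 = ln (card Om)"
    using card_Om_pos by (simp add: mean_ln_def ext_Nil)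
  finally show ?thesis using card_Om_pos by simp
qed

lemma exp_average_le:
  "exp ((\<Sum>xs\<in>Om. f xs) / card Om) \<le> (\<Sum>xs\<in>Om. exp (f xs)) / card Om"
  using exp_mean_le [OF fin, of "\<lambda>_. 1 / card Om" f] card_Om_pos
  by (simp add: sum_divide_distrib)

text \<open>
  The uniform law maximises the entropy of a single entry.
\<close>

lemma eff_k_le:
  assumes "k \<ge> 1"
  shows "eff k \<le> card letters"
proof -
  have "eff k = exp ((\<Sum>xs\<in>Om. ln (ext []) - ln (ext [xs ! 0])) / card Om)"
  proof -
    have "take (Suc 0) xs = [xs ! 0]" if "xs \<in> Om" for xs
      using len [OF that] assms by (cases xs) auto
    then show ?thesis
      by (simp add: eff_def mean_ln_def sum_subtractf diff_divide_distrib)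
  qed
  also have "\<dots> \<le> (\<Sum>xs\<in>Om. exp (ln (ext []) - ln (ext [xs ! 0]))) / card Om"
    by (rule exp_average_le)
  also have "(\<Sum>xs\<in>Om. exp (ln (ext []) - ln (ext [xs ! 0]))) = (\<Sum>xs\<in>Om. (\<lambda>ys v. ext [] / ext [v]) (take 0 xs) (xs ! 0))"
  proof (rule sum.cong)
    fix xs assume "xs \<in> Om"
    then have "ext [xs ! 0] > 0"
      using ext_take_pos [of xs 1] len [of xs] assms by (cases xs) auto
    then show "exp (ln (ext []) - ln (ext [xs ! 0])) = (\<lambda>ys v. ext [] / ext [v]) (take 0 xs) (xs ! 0)"
      using card_Om_pos by (simp add: exp_diff ext_Nil)
  qed simp
  also have "\<dots> = (\<Sum>xs\<in>Om. \<Sum>v\<in>letters. ext (take 0 xs @ [v]) / ext (take 0 xs) * (ext [] / ext [v]))"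
    by (rule resample [symmetric]) (use assms in simp)
  also have "\<dots> \<le> (\<Sum>xs\<in>Om. \<Sum>v\<in>letters. 1)"
    by (intro sum_mono) (use card_Om_pos in \<open>simp add: ext_Nil\<close>)
  also have "\<dots> / card Om = card letters"
    using card_Om_pos by simp
  finally show ?thesis by (simp add: divide_right_mono)
qed

text \<open>
  Minus the Kullback-Leibler divergence of the law of a new entry given the prefix \<open>T\<close> from its law
  given the prefix \<open>W\<close>.  Entries \<open>v\<close> that are impossible after \<open>T\<close> contribute \<open>0\<close> because of
  the factor \<open>ext (T @ [v])\<close>.
\<close>

definition neg_KL :: "'b list \<Rightarrow> 'b list \<Rightarrow> real" where
  "neg_KL W T = (\<Sum>v\<in>letters. ext (T @ [v]) / ext T * (ln (ext (W @ [v]) / ext W) - ln (ext (T @ [v]) / ext T)))"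

text \<open>
  By Jensen's inequality the divergence is controlled by the mass that the law given \<open>W\<close> puts on the
  support of the law given \<open>W @ A\<close>.  Using only this mass, rather than \<open>1\<close>, is what
  lets two laws with disjoint supports share the total mass \<open>1\<close>.
\<close>

lemma exp_neg_KL_le:
  assumes "ext (W @ A) > 0" and "length (W @ A) < k"
  shows "exp (neg_KL W (W @ A)) \<le> (\<Sum>v | v \<in> letters \<and> ext (W @ A @ [v]) > 0. ext (W @ [v]) / ext W)"
proof -
  let ?S = "{v \<in> letters. ext (W @ A @ [v]) > 0}" and ?p = "\<lambda>v. ext (W @ A @ [v]) / ext (W @ A)"
  have pW: "ext (W @ [v]) > 0" if "v \<in> ?S" for v
  proof -
    obtain zs where "W @ A @ [v] @ zs \<in> Om" using \<open>v \<in> ?S\<close> by (auto simp: ext_pos_iff)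
    then have "W @ [v] @ A @ zs \<in> Om" by (rule perm) simp
    then show ?thesis by (auto simp: ext_pos_iff)
  qed
  have pos: "ext W > 0" using assms(1) by (auto simp: ext_pos_iff)
  have restrict: "(\<Sum>v\<in>letters. ?p v * h v) = (\<Sum>v\<in>?S. ?p v * h v)" for h
    by (rule sum.mono_neutral_right) (use finite_letters ext_nonneg in \<open>auto simp: less_le\<close>)
  have one: "(\<Sum>v\<in>?S. ?p v) = 1"
    using restrict [of "\<lambda>_. 1"] sum_ext_snoc [of "W @ A"] assms by (simp add: sum_divide_distrib [symmetric])
  have "exp (neg_KL W (W @ A)) \<le> (\<Sum>v\<in>?S. ?p v * exp (ln (ext (W @ [v]) / ext W) - ln (?p v)))"
    unfolding neg_KL_def append_assoc restrict
    by (rule exp_mean_le [OF _ _ one]) (use finite_letters ext_nonneg in auto)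
  also have "\<dots> = (\<Sum>v\<in>?S. ext (W @ [v]) / ext W)"
    using pW pos assms(1) by (intro sum.cong) (auto simp: exp_diff divide_simps)
  finally show ?thesis .
qed

text \<open>
  Averaged over the tuples, the negated divergence becomes a difference of two conditional entropies:
  the resampled entry may be replaced by the actual entry \<open>w + b\<close>, and by symmetry this entry
  may be moved next to the first \<open>w\<close> entries.
\<close>

lemma average_neg_KL:
  assumes "w + b < k"
  shows "(\<Sum>xs\<in>Om. neg_KL (take w xs) (take (w + b) xs)) / card Om
       = (mean_ln (Suc w) - mean_ln w) - (mean_ln (Suc (w + b)) - mean_ln (w + b))"
proof -
  let ?j = "w + b"
  have "(\<Sum>xs\<in>Om. neg_KL (take w xs) (take ?j xs))
      = (\<Sum>xs\<in>Om. \<Sum>v\<in>letters. ext (take ?j xs @ [v]) / ext (take ?j xs) *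
           (\<lambda>T v. ln (ext (take w T @ [v]) / ext (take w T)) - ln (ext (T @ [v]) / ext T)) (take ?j xs) v)"
    by (simp add: neg_KL_def min_def)
  also have "\<dots> = (\<Sum>xs\<in>Om. ln (ext (take w xs @ [xs ! ?j]) / ext (take w xs)) -
           ln (ext (take ?j xs @ [xs ! ?j]) / ext (take ?j xs)))"
    by (subst resample [OF assms]) (simp add: min_def)
  also have "\<dots> = (\<Sum>xs\<in>Om. ln (ext (take (Suc w) (block_swap w b 1 xs))) - ln (ext (take w xs)) -
           (ln (ext (take (Suc ?j) xs)) - ln (ext (take ?j xs))))"
  proof (rule sum.cong)
    fix xs assume xs: "xs \<in> Om"
    obtain W P Q R where s: "xs = W @ P @ Q @ R" "length W = w" "length P = b" "length Q = 1"
      by (rule split4 [OF xs, of w b 1]) (use assms in simp, blast)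
    then obtain q where q: "Q = [q]" by (auto simp: length_Suc_conv)
    have "W @ q # P @ R \<in> Om" using xs by (rule perm) (simp add: s q)
    then have "ext (W @ [q]) > 0" "ext (W @ P @ [q]) > 0" "ext W > 0" "ext (W @ P) > 0"
      using xs by (auto simp: ext_pos_iff s q)
    moreover have "block_swap w b 1 xs = W @ [q] @ P @ R"
      unfolding s(1) q by (rule block_swap_append) (use s in auto)
    ultimately show "ln (ext (take w xs @ [xs ! ?j]) / ext (take w xs)) -
           ln (ext (take ?j xs @ [xs ! ?j]) / ext (take ?j xs)) =
        ln (ext (take (Suc w) (block_swap w b 1 xs))) - ln (ext (take w xs)) -
           (ln (ext (take (Suc ?j) xs)) - ln (ext (take ?j xs)))"
      using s q by (simp add: ln_div nth_append)
  qed simp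
  also have "\<dots> = (\<Sum>xs\<in>Om. ln (ext (take (Suc w) xs))) - (\<Sum>xs\<in>Om. ln (ext (take w xs))) -
           ((\<Sum>xs\<in>Om. ln (ext (take (Suc ?j) xs))) - (\<Sum>xs\<in>Om. ln (ext (take ?j xs))))"
    using assms sum_block_swap [of w b 1 "\<lambda>xs. ln (ext (take (Suc w) xs))"]
    by (simp add: sum_subtractf)
  finally show ?thesis
    by (simp add: mean_ln_def diff_divide_distrib)
qed

text \<open>
  For a tuple \<open>W @ A @ B\<close>, the laws of a new entry given \<open>W @ A\<close> and given \<open>W @ B\<close> have
  disjoint supports, so \<open>exp_neg_KL_le\<close> gives
  \<open>exp (neg_KL W (W @ A)) + exp (neg_KL W (W @ B)) \<le> 1\<close>.  Averaging inside the exponentials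
  yields \<open>eff a / eff (a + b) + eff b / eff (a + b) \<le> 1\<close>.
\<close>

lemma eff_superadditive:
  assumes ab: "a \<ge> 1" "b \<ge> 1" "a + b \<le> k"
    and disj: "\<And>W A B v. W @ A @ B \<in> Om \<Longrightarrow> length A = b \<Longrightarrow> length B = a \<Longrightarrow>
                 ext (W @ A @ [v]) > 0 \<Longrightarrow> ext (W @ B @ [v]) > 0 \<Longrightarrow> False"
  shows "eff a + eff b \<le> eff (a + b)"
proof -
  define w where "w = k - (a + b)"
  have k: "k = w + a + b" using ab by (simp add: w_def)
  define f where "f xs = neg_KL (take w xs) (take (w + b) xs)" for xs
  define g where "g xs = neg_KL (take w xs) (take (w + a) xs)" for xs
  let ?c = "real (card Om)"
  have pointwise: "exp (f xs) + exp (g (block_swap w b a xs)) \<le> 1" if xs: "xs \<in> Om" for xs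
  proof -
    obtain W A B R where s: "xs = W @ A @ B @ R" "length W = w" "length A = b" "length B = a"
      by (rule split4 [OF xs, of w b a]) (use k in simp, blast)
    then have R: "R = []" using len [OF xs] k by auto
    have swapped: "W @ B @ A \<in> Om" using xs by (rule perm) (simp add: s R)
    have pos: "ext (W @ A) > 0" "ext (W @ B) > 0" "ext W > 0"
      using xs swapped by (auto simp: ext_pos_iff s R)
    let ?A = "{v \<in> letters. ext (W @ A @ [v]) > 0}" and ?B = "{v \<in> letters. ext (W @ B @ [v]) > 0}"
    have AB: "?A \<inter> ?B = {}" using disj [of W A B] xs s R by auto
    have "exp (f xs) + exp (g (block_swap w b a xs)) = exp (neg_KL W (W @ A)) + exp (neg_KL W (W @ B))"
      using s by (simp add: f_def g_def block_swap_append)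
    also have "\<dots> \<le> (\<Sum>v\<in>?A. ext (W @ [v]) / ext W) + (\<Sum>v\<in>?B. ext (W @ [v]) / ext W)"
      using pos ab k s by (intro add_mono exp_neg_KL_le) auto
    also have "\<dots> = (\<Sum>v\<in>?A \<union> ?B. ext (W @ [v]) / ext W)"
      using finite_letters AB by (intro sum.union_disjoint [symmetric]) auto
    also have "\<dots> \<le> (\<Sum>v\<in>letters. ext (W @ [v]) / ext W)"
      by (rule sum_mono2) (use finite_letters ext_nonneg in auto)
    also have "\<dots> = 1"
      using sum_ext_snoc [of W] pos ab k s by (simp add: sum_divide_distrib [symmetric])
    finally show ?thesis .
  qed
  have "exp ((\<Sum>xs\<in>Om. f xs) / ?c) + exp ((\<Sum>xs\<in>Om. g xs) / ?c)
      = exp ((\<Sum>xs\<in>Om. f xs) / ?c) + exp ((\<Sum>xs\<in>Om. g (block_swap w b a xs)) / ?c)"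
    using k by (simp add: sum_block_swap)
  also have "\<dots> \<le> (\<Sum>xs\<in>Om. exp (f xs)) / ?c + (\<Sum>xs\<in>Om. exp (g (block_swap w b a xs))) / ?c"
    by (intro add_mono exp_average_le)
  also have "\<dots> = (\<Sum>xs\<in>Om. exp (f xs) + exp (g (block_swap w b a xs))) / ?c"
    by (simp add: sum.distrib add_divide_distrib)
  also have "\<dots> \<le> (\<Sum>xs\<in>Om. 1) / ?c"
    by (intro divide_right_mono sum_mono pointwise) auto
  also have "\<dots> = 1" using card_Om_pos by simp
  finally have main: "exp ((\<Sum>xs\<in>Om. f xs) / ?c) + exp ((\<Sum>xs\<in>Om. g xs) / ?c) \<le> 1" .
  have "(\<Sum>xs\<in>Om. f xs) / ?c = (mean_ln (w + b) - mean_ln (Suc (w + b))) - (mean_ln w - mean_ln (Suc w))"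
    "(\<Sum>xs\<in>Om. g xs) / ?c = (mean_ln (w + a) - mean_ln (Suc (w + a))) - (mean_ln w - mean_ln (Suc w))"
    using average_neg_KL [of w b] average_neg_KL [of w a] ab k by (simp_all add: f_def g_def)
  moreover have ks: "k - a = w + b" "k - b = w + a" "k - (a + b) = w" using k by simp_all
  ultimately have "exp ((\<Sum>xs\<in>Om. f xs) / ?c) = eff a / eff (a + b)" "exp ((\<Sum>xs\<in>Om. g xs) / ?c) = eff b / eff (a + b)"
    by (simp_all add: eff_def exp_diff ks)
  with main have "(eff a + eff b) / eff (a + b) \<le> 1" by (simp add: add_divide_distrib)
  then show ?thesis by (simp add: eff_def divide_le_eq)
qed

theorem card_le:
  assumes "k \<ge> 1"
    and disj: "\<And>W A B v. W @ A @ B \<in> Om \<Longrightarrow> A \<noteq> [] \<Longrightarrow> B \<noteq> [] \<Longrightarrow>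
                 ext (W @ A @ [v]) > 0 \<Longrightarrow> ext (W @ B @ [v]) > 0 \<Longrightarrow> False"
  shows "real (card Om) \<le> fact k * (card letters / k) ^ k"
proof -
  have "real (card Om) \<le> fact k * (eff k / k) ^ k"
    unfolding prod_eff [symmetric]
  proof (rule superadditive_prod_le [OF assms(1)])
    fix a b :: nat assume "a \<ge> 1" "b \<ge> 1" "a + b \<le> k"
    then show "eff a + eff b \<le> eff (a + b)"
    proof (rule eff_superadditive)
      fix W A B v
      assume "length A = b" "length B = a" "W @ A @ B \<in> Om" "ext (W @ A @ [v]) > 0" "ext (W @ B @ [v]) > 0"
      moreover have "A \<noteq> []" "B \<noteq> []"
        using \<open>a \<ge> 1\<close> \<open>b \<ge> 1\<close> \<open>length A = b\<close> \<open>length B = a\<close> by auto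
      ultimately show False using disj by blast
    qed
  qed (simp add: eff_def)
  also have "\<dots> \<le> fact k * (card letters / k) ^ k"
    using eff_k_le [OF assms(1)]
    by (intro mult_left_mono power_mono divide_right_mono) (auto simp: eff_def)
  finally show ?thesis .
qed

end

section \<open>Uniform hypergraphs with no covered outer vertex\<close>

text \<open>
  Apply \<open>symmetric_tuples.card_le\<close> to the ordered edges.  The sets \<open>S\<close> and \<open>T\<close> are
  \<open>W \<union> A\<close> and \<open>W \<union> B\<close>.  Since they cover an edge, one of them has at least \<open>k/2\<close> elements, and
  the roles of \<open>S\<close> and \<open>T\<close> are symmetric; so it suffices to exclude the case where this is \<open>S\<close>.
\<close>

lemma card_uniform_le_if_no_cover:
  fixes E :: "'b set set"
  assumes k: "k \<ge> 1" and "finite U" and E: "\<And>e. e \<in> E \<Longrightarrow> e \<subseteq> U \<and> card e = k"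
    and no: "\<And>S T v. S \<union> T \<in> E \<Longrightarrow> v \<notin> S \<union> T \<Longrightarrow> k \<le> 2 * card S \<Longrightarrow>
               \<exists>f\<in>E. insert v S \<subseteq> f \<Longrightarrow> \<exists>f\<in>E. insert v T \<subseteq> f \<Longrightarrow> False"
  shows "real (card E) \<le> (card U / k) ^ k"
proof (cases "E = {}")
  case False
  define Om where "Om = (\<Union>e\<in>E. permutations_of_set e)"
  have Om_iff: "xs \<in> Om \<longleftrightarrow> set xs \<in> E \<and> distinct xs" for xs
    by (auto simp: Om_def permutations_of_set_def)
  have "E \<subseteq> Pow U" using E by blast
  then have finE: "finite E" using \<open>finite U\<close> by (rule finite_subset [OF _ finite_Pow_iff [THEN iffD2]])
  have fine: "finite e" if "e \<in> E" for e using E that \<open>finite U\<close> finite_subset by blast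
  have "card Om = (\<Sum>e\<in>E. card (permutations_of_set e))"
    unfolding Om_def using finE by (rule card_UN_disjoint) (auto dest: permutations_of_setD)
  also have "\<dots> = (\<Sum>e\<in>E. fact k)"
    using E fine by (intro sum.cong) auto
  finally have card_Om: "card Om = card E * fact k" by simp
  interpret symmetric_tuples k Om
  proof
    show "finite Om" using finE fine by (auto simp: Om_def)
    show "Om \<noteq> {}" using card_Om False finE by (metis card.empty card_eq_0_iff fact_nonzero mult_eq_0_iff)
    show "length xs = k" if "xs \<in> Om" for xs
      using that E distinct_card [of xs] by (auto simp: Om_iff)
    show "ys \<in> Om" if "xs \<in> Om" "mset ys = mset xs" for xs ys
      using that by (metis Om_iff mset_eq_setD mset_eq_imp_distinct_iff)
  qed
  have "real (card Om) \<le> fact k * (card letters / k) ^ k"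
  proof (rule card_le [OF k])
    fix W A B v
    assume e: "W @ A @ B \<in> Om" and "ext (W @ A @ [v]) > 0" "ext (W @ B @ [v]) > 0"
    then obtain ps qs where ps: "W @ A @ v # ps \<in> Om" and qs: "W @ B @ v # qs \<in> Om"
      by (auto simp: ext_pos_iff)
    let ?S = "set (W @ A)" and ?T = "set (W @ B)"
    have dS: "distinct (W @ A)" and dT: "distinct (W @ B)" using e by (auto simp: Om_iff)
    have cards: "card ?S = length (W @ A)" "card ?T = length (W @ B)"
      by (rule distinct_card, fact)+
    have v: "v \<notin> ?S \<union> ?T" using ps qs by (auto simp: Om_iff)
    have edge: "?S \<union> ?T \<in> E" "?T \<union> ?S \<in> E" using e by (simp_all add: Om_iff Un_ac)
    have S: "\<exists>f\<in>E. insert v ?S \<subseteq> f"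
      using ps by (intro bexI [of _ "set (W @ A @ v # ps)"]) (auto simp: Om_iff)
    have T: "\<exists>f\<in>E. insert v ?T \<subseteq> f"
      using qs by (intro bexI [of _ "set (W @ B @ v # qs)"]) (auto simp: Om_iff)
    have "k \<le> 2 * card ?S \<or> k \<le> 2 * card ?T"
      unfolding cards using len [OF e] by simp linarith
    then show False
      using no [of ?S ?T v] no [of ?T ?S v] v edge S T by blast
  qed
  also have "\<dots> \<le> fact k * (card U / k) ^ k"
  proof -
    have "letters \<subseteq> U" using E unfolding letters_def Om_iff by (blast dest: Om_iff [THEN iffD1])
    then have "card letters \<le> card U" using \<open>finite U\<close> by (rule card_mono [rotated])
    then show ?thesis by (intro mult_left_mono power_mono divide_right_mono) auto
  qed
  finally show ?thesis by (simp add: card_Om)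
qed simp

section \<open>Pruning to a flexible hypergraph\<close>

definition flexible :: "nat \<Rightarrow> 'b set set \<Rightarrow> bool" where
  "flexible K E \<longleftrightarrow>
     (\<forall>f\<in>E. \<forall>S\<subseteq>f. \<forall>Z. finite Z \<and> card Z \<le> K \<longrightarrow> (\<exists>g\<in>E. S \<subseteq> g \<and> g \<inter> Z \<subseteq> S))"

lemma flexibleD:
  "flexible K E \<Longrightarrow> f \<in> E \<Longrightarrow> S \<subseteq> f \<Longrightarrow> finite Z \<Longrightarrow> card Z \<le> K \<Longrightarrow>
     \<exists>g\<in>E. S \<subseteq> g \<and> g \<inter> Z \<subseteq> S"
  by (simp add: flexible_def)

lemma binomial_le_power: "n choose r \<le> n ^ r"
  by (cases "r \<le> n") (simp_all add: binomial_le_pow binomial_eq_0)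

lemma card_supersets_le:
  assumes "finite U" and E: "\<And>e. e \<in> E \<Longrightarrow> e \<subseteq> U \<and> card e = k" and "finite T"
  shows "card {f \<in> E. T \<subseteq> f} \<le> card U ^ (k - card T)"
proof -
  have "inj_on (\<lambda>f. f - T) {f \<in> E. T \<subseteq> f}" by (rule inj_onI) blast
  moreover have "(\<lambda>f. f - T) ` {f \<in> E. T \<subseteq> f} \<subseteq> {g. g \<subseteq> U \<and> card g = k - card T}"
    using E \<open>finite T\<close> by (auto simp: card_Diff_subset)
  ultimately have "card {f \<in> E. T \<subseteq> f} \<le> card {g. g \<subseteq> U \<and> card g = k - card T}"
    using \<open>finite U\<close> by (intro card_inj_on_le) auto
  then show ?thesis
    using n_subsets [OF \<open>finite U\<close>, of "k - card T"] binomial_le_power le_trans by metis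
qed

definition proper_shadow :: "'b set set \<Rightarrow> 'b set set" where
  "proper_shadow E = {S. \<exists>f\<in>E. S \<subset> f}"

text \<open>
  If some \<open>S\<close> violates flexibility, then every edge through \<open>S\<close> meets one of at most \<open>K\<close> vertices
  outside \<open>S\<close>, so there are at most \<open>w S\<close> such edges.  Deleting them removes \<open>S\<close> from the proper
  shadow for good, so each lost edge can be charged to the weight of such an \<open>S\<close>.
\<close>

lemma exists_flexible_weighted:
  fixes E :: "'b set set" and K :: nat
  assumes "finite U" and "\<And>e. e \<in> E \<Longrightarrow> e \<subseteq> U \<and> card e = k"
  defines "w \<equiv> \<lambda>S. K * card U ^ (k - 1 - card S)"
  shows "\<exists>E'\<subseteq>E. flexible K E' \<and>
           card E + sum w (proper_shadow E') \<le> card E' + sum w (proper_shadow E)"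
  using assms(2)
proof (induction "card E" arbitrary: E rule: less_induct)
  case less
  note E = less.prems
  show ?case
  proof (cases "flexible K E")
    case False
    then obtain f S Z where f: "f \<in> E" "S \<subseteq> f" and Z: "finite Z" "card Z \<le> K"
      and "\<not> (\<exists>g\<in>E. S \<subseteq> g \<and> g \<inter> Z \<subseteq> S)"
      unfolding flexible_def by meson
    then have hit: "\<And>g. g \<in> E \<Longrightarrow> S \<subseteq> g \<Longrightarrow> \<not> g \<inter> Z \<subseteq> S" by blast
    have "E \<subseteq> Pow U" using E by blast
    then have finE: "finite E" using \<open>finite U\<close> by (rule finite_subset [OF _ finite_Pow_iff [THEN iffD2]])
    have fine: "finite e" if "e \<in> E" for e using E that \<open>finite U\<close> finite_subset by blast
    have "S \<noteq> f" using hit [OF f] by blast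
    with f have Sf: "S \<subset> f" by blast
    then have "card S < k" using psubset_card_mono fine [OF f(1)] E [OF f(1)] by blast
    have finS: "finite S" using f fine finite_subset by blast
    define D where "D = {g \<in> E. S \<subseteq> g}"
    have "card D \<le> card (\<Union>z\<in>Z - S. {g \<in> E. insert z S \<subseteq> g})"
      using hit finE Z by (intro card_mono) (auto simp: D_def)
    also have "\<dots> \<le> (\<Sum>z\<in>Z - S. card {g \<in> E. insert z S \<subseteq> g})"
      using Z by (intro card_UN_le) auto
    also have "\<dots> \<le> (\<Sum>z\<in>Z - S. card U ^ (k - 1 - card S))"
    proof (rule sum_mono)
      fix z assume "z \<in> Z - S"
      then show "card {g \<in> E. insert z S \<subseteq> g} \<le> card U ^ (k - 1 - card S)"
        using card_supersets_le [of U E k "insert z S"] E finS \<open>finite U\<close> by simp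
    qed
    also have "\<dots> \<le> w S"
      using Z card_mono [of Z "Z - S"] by (simp add: w_def mult_le_mono1)
    finally have D: "card D \<le> w S" .
    let ?E = "E - D"
    have "f \<in> D" using f by (simp add: D_def)
    then have "card ?E < card E" using f finE by (intro psubset_card_mono) auto
    moreover have "\<And>e. e \<in> ?E \<Longrightarrow> e \<subseteq> U \<and> card e = k" using E by blast
    ultimately have "\<exists>E'\<subseteq>?E. flexible K E' \<and>
        card ?E + sum w (proper_shadow E') \<le> card E' + sum w (proper_shadow ?E)"
      by (rule less.hyps)
    then obtain E' where E': "E' \<subseteq> ?E" "flexible K E'"
      "card ?E + sum w (proper_shadow E') \<le> card E' + sum w (proper_shadow ?E)"
      by (elim exE conjE)
    have "card E = card ?E + card D"
      using finE by (simp add: D_def card_Diff_subset card_mono)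
    moreover have "sum w (proper_shadow ?E) + w S \<le> sum w (proper_shadow E)"
    proof -
      have fin: "finite (proper_shadow E)"
        by (rule finite_subset [of _ "Pow U"]) (use E \<open>finite U\<close> in \<open>auto simp: proper_shadow_def\<close>)
      have sub: "insert S (proper_shadow ?E) \<subseteq> proper_shadow E"
        using Sf f by (auto simp: proper_shadow_def)
      have "S \<notin> proper_shadow ?E" by (auto simp: proper_shadow_def D_def)
      then have "sum w (proper_shadow ?E) + w S = sum w (insert S (proper_shadow ?E))"
        using sub fin finite_subset by (subst sum.insert) auto
      also have "\<dots> \<le> sum w (proper_shadow E)"
        by (rule sum_mono2 [OF fin sub]) simp
      finally show ?thesis .
    qed
    ultimately show ?thesis using E' D by (intro exI [of _ E']) auto
  qed blast
qed

text \<open>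
  With \<open>n = card U\<close>, the total weight is \<open>O(n^(k-1))\<close>, since there are at most \<open>n^s\<close> sets of size \<open>s\<close> and each of
  them has weight \<open>K * n^(k-1-s)\<close>.
\<close>

lemma exists_flexible_subset:
  fixes E :: "'b set set"
  assumes "finite U" and E: "\<And>e. e \<in> E \<Longrightarrow> e \<subseteq> U \<and> card e = k"
  shows "\<exists>E'\<subseteq>E. flexible K E' \<and> card E \<le> card E' + k * K * card U ^ (k - 1)"
proof -
  let ?n = "card U"
  let ?w = "\<lambda>S. K * ?n ^ (k - 1 - card S)"
  have "sum ?w (proper_shadow E) \<le> sum ?w {S. S \<subseteq> U \<and> card S < k}"
  proof (rule sum_mono2)
    show "proper_shadow E \<subseteq> {S. S \<subseteq> U \<and> card S < k}"
    proof
      fix S assume "S \<in> proper_shadow E"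
      then obtain f where f: "f \<in> E" "S \<subset> f" by (auto simp: proper_shadow_def)
      then have "card S < card f" using E [OF f(1)] \<open>finite U\<close> by (meson finite_subset psubset_card_mono)
      then show "S \<in> {S. S \<subseteq> U \<and> card S < k}" using f E [OF f(1)] by auto
    qed
  qed (use \<open>finite U\<close> in auto)
  also have "{S. S \<subseteq> U \<and> card S < k} = (\<Union>s<k. {S. S \<subseteq> U \<and> card S = s})" by auto
  also have "sum ?w \<dots> = (\<Sum>s<k. \<Sum>S | S \<subseteq> U \<and> card S = s. ?w S)"
    using \<open>finite U\<close> by (intro sum.UNION_disjoint) auto
  also have "\<dots> = (\<Sum>s<k. (?n choose s) * (K * ?n ^ (k - 1 - s)))"
    using \<open>finite U\<close> by (intro sum.cong) (auto simp: n_subsets)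
  also have "\<dots> \<le> (\<Sum>s<k. K * ?n ^ (k - 1))"
  proof (rule sum_mono)
    fix s assume "s \<in> {..<k}"
    then have "?n ^ s * ?n ^ (k - 1 - s) = ?n ^ (k - 1)" by (simp flip: power_add)
    then show "(?n choose s) * (K * ?n ^ (k - 1 - s)) \<le> K * ?n ^ (k - 1)"
      using mult_right_mono [OF binomial_le_power [of ?n s], of "K * ?n ^ (k - 1 - s)"]
      by (simp add: algebra_simps)
  qed
  finally have "sum ?w (proper_shadow E) \<le> k * K * ?n ^ (k - 1)" by simp
  with exists_flexible_weighted [OF assms, where K = K] show ?thesis
    by (meson add_leD1 add_left_mono order_trans)
qed

section \<open>Embedding tents\<close>

text \<open>
  Choose the edges one after the other, each time avoiding the base \<open>e\<close> and all edges chosen before.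
  These have at most \<open>l * k\<close> vertices in total, whence the requirement on \<open>K\<close>.
\<close>

lemma flexible_attach_edges:
  fixes E :: "'b set set"
  assumes flex: "flexible K E" and E: "\<And>f. f \<in> E \<Longrightarrow> finite f \<and> card f = k"
    and e: "e \<in> E" "v \<notin> e"
    and A: "\<And>i. i < l \<Longrightarrow> A i \<subseteq> e \<and> (\<exists>f\<in>E. insert v (A i) \<subseteq> f)"
    and disj: "\<And>i j. i < l \<Longrightarrow> j < l \<Longrightarrow> i \<noteq> j \<Longrightarrow> A i \<inter> A j = {}"
    and K: "l * k \<le> K"
  shows "\<exists>es. \<forall>i<l. es i \<in> E \<and> v \<in> es i \<and> es i \<inter> e = A i \<and> (\<forall>j<i. es i \<inter> es j = {v})"
proof -
  have "\<exists>es. \<forall>i<m. es i \<in> E \<and> v \<in> es i \<and> es i \<inter> e = A i \<and> (\<forall>j<i. es i \<inter> es j = {v})" if "m \<le> l" for m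
    using that
  proof (induction m)
    case (Suc m)
    then obtain es where es: "\<forall>i<m. es i \<in> E \<and> v \<in> es i \<and> es i \<inter> e = A i \<and> (\<forall>j<i. es i \<inter> es j = {v})"
      by auto
    let ?Z = "e \<union> (\<Union>i<m. es i)"
    have "card ?Z \<le> card e + card (\<Union>i<m. es i)" by (rule card_Un_le)
    also have "card (\<Union>i<m. es i) \<le> (\<Sum>i<m. card (es i))" by (rule card_UN_le) simp
    also have "\<dots> = m * k" using es E by simp
    also have "card e + m * k \<le> K"
      using E [OF e(1)] K mult_le_mono1 [OF Suc.prems, of k] by simp
    finally have "card ?Z \<le> K" by simp
    moreover have "finite ?Z" using es E e by (intro finite_UnI finite_UN_I) blast+
    moreover obtain f where "f \<in> E" "insert v (A m) \<subseteq> f" using A Suc.prems by (meson Suc_le_lessD)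
    ultimately obtain g where g: "g \<in> E" "insert v (A m) \<subseteq> g" "g \<inter> ?Z \<subseteq> insert v (A m)"
      using flexibleD [OF flex] by meson
    have Am: "A m \<subseteq> e" using A Suc.prems by simp
    have ge: "g \<inter> e = A m" using g(2,3) e(2) Am by blast
    have gj: "g \<inter> es j = {v}" if "j < m" for j
    proof -
      have "g \<inter> es j \<subseteq> insert v (A m \<inter> (es j \<inter> e))" using g(3) that ge by blast
      moreover have "es j \<inter> e = A j" "v \<in> es j" using es that by simp_all
      moreover have "A m \<inter> A j = {}" using that disj [of m j] Suc.prems by simp
      ultimately show ?thesis using g(2) by auto
    qed
    show ?case
    proof (intro exI [of _ "es(m := g)"] allI impI)
      fix i assume "i < Suc m"
      then consider "i < m" | "i = m" by linarith
      then show "(es(m := g)) i \<in> E \<and> v \<in> (es(m := g)) i \<and> (es(m := g)) i \<inter> e = A i \<and>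
          (\<forall>j<i. (es(m := g)) i \<inter> (es(m := g)) j = {v})"
      proof cases
        case 1 then show ?thesis using es by simp
      next
        case 2 then show ?thesis using g(1,2) ge gj by simp
      qed
    qed
  qed simp
  then show ?thesis by blast
qed

lemma is_tentE:
  assumes "is_tent lam F"
  obtains b es v where "edges F = insert b (es ` {..<length lam})" "verts F = \<Union> (edges F)" "v \<notin> b"
    and "\<forall>i<length lam. v \<in> es i \<and> card (es i \<inter> b) = lam ! i"
    and "\<forall>i<length lam. \<forall>j<length lam. i \<noteq> j \<longrightarrow> es i \<inter> es j = {v}"
  using assms unfolding is_tent_def by (elim conjE exE)

lemma tent_base_eq_Union:
  fixes es :: "nat \<Rightarrow> 'b set"
  assumes "finite b" "card b = sum_list lam" "v \<notin> b"
    and parts: "\<And>i. i < length lam \<Longrightarrow> card (es i \<inter> b) = lam ! i"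
    and meet: "\<And>i j. i < length lam \<Longrightarrow> j < length lam \<Longrightarrow> i \<noteq> j \<Longrightarrow> es i \<inter> es j = {v}"
  shows "b = (\<Union>i<length lam. es i \<inter> b)"
proof (rule card_subset_eq [symmetric])
  have "card (\<Union>i<length lam. es i \<inter> b) = (\<Sum>i<length lam. card (es i \<inter> b))"
  proof (rule card_UN_disjoint)
    show "\<forall>i\<in>{..<length lam}. \<forall>j\<in>{..<length lam}. i \<noteq> j \<longrightarrow> es i \<inter> b \<inter> (es j \<inter> b) = {}"
    proof (intro ballI impI)
      fix i j assume "i \<in> {..<length lam}" "j \<in> {..<length lam}" "i \<noteq> j"
      then have "es i \<inter> es j = {v}" using meet by simp
      then have "es i \<inter> b \<inter> (es j \<inter> b) = {v} \<inter> b" by (simp add: Int_ac)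
      then show "es i \<inter> b \<inter> (es j \<inter> b) = {}" using \<open>v \<notin> b\<close> by simp
    qed
  qed (use \<open>finite b\<close> in auto)
  also have "\<dots> = sum_list lam"
    using parts by (simp add: sum_list_sum_nth atLeast0LessThan)
  finally show "card (\<Union>i<length lam. es i \<inter> b) = card b" using assms by simp
qed (use \<open>finite b\<close> in auto)

text \<open>
  Used to match one arm of a tent with the corresponding arm of another one, respecting
  base and apex.
\<close>

lemma exists_bij_preserving_part_and_point:
  assumes "finite X" "finite Y" "card X = card Y" "card (X \<inter> B) = card (Y \<inter> C)"
    and v: "v \<in> X" "v \<notin> B" and w: "w \<in> Y" "w \<notin> C"
  obtains f where "bij_betw f X Y" "f ` (X \<inter> B) = Y \<inter> C" "f v = w"
proof -
  obtain g where g: "bij_betw g (X \<inter> B) (Y \<inter> C)"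
    using assms by (meson finite_Int finite_same_card_bij)
  have "card (X - B - {v}) = card (Y - C - {w})"
    using assms by (simp add: card_Diff_subset_Int)
  then obtain h where h: "bij_betw h (X - B - {v}) (Y - C - {w})"
    using assms by (meson finite_Diff finite_same_card_bij)
  define f where "f x = (if x = v then w else if x \<in> B then g x else h x)" for x
  have "bij_betw f {v} {w}" by (simp add: f_def)
  moreover have "bij_betw f (X \<inter> B) (Y \<inter> C)"
    using g by (rule bij_betw_cong [THEN iffD1, rotated]) (use v in \<open>auto simp: f_def\<close>)
  moreover have "bij_betw f (X - B - {v}) (Y - C - {w})"
    using h by (rule bij_betw_cong [THEN iffD1, rotated]) (auto simp: f_def)
  ultimately have "bij_betw f ({v} \<union> (X \<inter> B) \<union> (X - B - {v})) ({w} \<union> (Y \<inter> C) \<union> (Y - C - {w}))"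
    using v w by (intro bij_betw_combine) auto
  moreover have "{v} \<union> (X \<inter> B) \<union> (X - B - {v}) = X" "{w} \<union> (Y \<inter> C) \<union> (Y - C - {w}) = Y"
    using v w by auto
  ultimately have "bij_betw f X Y" by metis
  moreover have "f ` (X \<inter> B) = Y \<inter> C"
    using \<open>bij_betw f (X \<inter> B) (Y \<inter> C)\<close> by (rule bij_betw_imp_surj_on)
  moreover have "f v = w" by (simp add: f_def)
  ultimately show ?thesis using that [of f] by simp
qed

text \<open>
  A tent is determined by its partition up to isomorphism.  The arms are matched one by one by
  bijections that respect base and apex.  As two arms share only the apex, these bijections glue
  to a single injective map.
\<close>

lemma contains_copy_tentI:
  fixes F :: "'a hypergraph" and G :: "'b hypergraph"
  assumes tent: "is_tent lam F" and G: "kgraph (sum_list lam) G"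
    and e: "e \<in> edges G" and v: "v \<notin> e"
    and es: "\<And>i. i < length lam \<Longrightarrow> es i \<in> edges G \<and> v \<in> es i \<and> card (es i \<inter> e) = lam ! i"
    and meet: "\<And>i j. i < length lam \<Longrightarrow> j < length lam \<Longrightarrow> i \<noteq> j \<Longrightarrow> es i \<inter> es j = {v}"
  shows "contains_copy G F"
proof -
  let ?l = "length lam"
  obtain b ds u where F: "edges F = insert b (ds ` {..<?l})" "verts F = \<Union> (edges F)" "u \<notin> b"
    and D: "\<forall>i<?l. u \<in> ds i \<and> card (ds i \<inter> b) = lam ! i"
      "\<forall>i<?l. \<forall>j<?l. i \<noteq> j \<longrightarrow> ds i \<inter> ds j = {u}"
    by (rule is_tentE [OF tent])
  note ds = D(1) [rule_format] and dmeet = D(2) [rule_format]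
  have kF: "kgraph (sum_list lam) F" using tent by (simp add: is_tent_def)
  have fin: "finite f \<and> card f = sum_list lam" if "f \<in> edges F" for f
    using that kF finite_subset by (auto simp: kgraph_def)
  have finG: "finite f \<and> card f = sum_list lam \<and> f \<subseteq> verts G" if "f \<in> edges G" for f
    using that G finite_subset by (auto simp: kgraph_def)
  have b: "b = (\<Union>i<?l. ds i \<inter> b)"
    by (rule tent_base_eq_Union [OF _ _ F(3) _ dmeet]) (use fin F(1) ds in simp_all)
  have eU: "e = (\<Union>i<?l. es i \<inter> e)"
    by (rule tent_base_eq_Union [OF _ _ v _ meet]) (use finG [OF e] es in simp_all)
  have "\<exists>f. bij_betw f (ds i) (es i) \<and> f ` (ds i \<inter> b) = es i \<inter> e \<and> f u = v" if "i < ?l" for i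
  proof (rule exists_bij_preserving_part_and_point [of "ds i" "es i" b e u v])
    show "finite (ds i)" "finite (es i)" "card (ds i) = card (es i)"
      using fin [of "ds i"] finG [of "es i"] es that F by auto
  qed (use ds es that F v in auto)
  then obtain f where f: "\<And>i. i < ?l \<Longrightarrow> bij_betw (f i) (ds i) (es i) \<and> f i ` (ds i \<inter> b) = es i \<inter> e \<and> f i u = v"
    by metis
  define h where "h x = f (SOME i. i < ?l \<and> x \<in> ds i) x" for x
  have h: "h x = f i x" if "i < ?l" "x \<in> ds i" for i x
  proof -
    define j where "j = (SOME i. i < ?l \<and> x \<in> ds i)"
    have j: "j < ?l" "x \<in> ds j"
      using someI [of "\<lambda>i. i < ?l \<and> x \<in> ds i" i] that by (simp_all add: j_def)
    have "x = u" if "i \<noteq> j" using dmeet [OF \<open>i < ?l\<close> j(1) that] j \<open>x \<in> ds i\<close> by blast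
    moreover have "h x = f j x" by (simp add: h_def j_def)
    ultimately show ?thesis using f [OF that(1)] f [OF j(1)] by (cases "i = j") auto
  qed
  have h_part: "h ` (ds i \<inter> b) = es i \<inter> e" and h_edge: "h ` ds i = es i" if "i < ?l" for i
  proof -
    have "h ` (ds i \<inter> b) = f i ` (ds i \<inter> b)" "h ` ds i = f i ` ds i"
      using h [OF that] by (auto intro!: image_cong)
    then show "h ` (ds i \<inter> b) = es i \<inter> e" "h ` ds i = es i"
      using f [OF that] by (auto simp: bij_betw_def)
  qed
  have "h ` b = h ` (\<Union>i<?l. ds i \<inter> b)" using b by simp
  also have "\<dots> = (\<Union>i<?l. h ` (ds i \<inter> b))" by (rule image_UN)
  also have "\<dots> = (\<Union>i<?l. es i \<inter> e)" by (rule SUP_cong) (simp_all add: h_part)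
  finally have h_base: "h ` b = e" using eU by simp
  have vF: "verts F = (\<Union>i<?l. ds i)"
  proof -
    have "b \<subseteq> (\<Union>i<?l. ds i)" by (subst b) blast
    then show ?thesis by (auto simp: F(1,2))
  qed
  have inj: "inj_on h (verts F)"
  proof (rule inj_onI)
    fix x y assume "x \<in> verts F" "y \<in> verts F" and eq: "h x = h y"
    then obtain i j where i: "i < ?l" "x \<in> ds i" and j: "j < ?l" "y \<in> ds j" by (auto simp: vF)
    have pre: "z = u" if "m < ?l" "z \<in> ds m" "h z = v" for m z
    proof -
      have "f m z = f m u" using f [OF that(1)] h that by auto
      then show ?thesis using f [OF that(1)] ds [OF that(1)] that(2) by (meson bij_betw_def inj_onD)
    qed
    show "x = y"
    proof (cases "i = j")
      case True
      then show ?thesis using f [OF i(1)] h i j eq by (metis bij_betw_def inj_onD)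
    next
      case False
      have "h x \<in> es i \<inter> es j" using h_edge i j eq by (metis IntI imageI)
      then have "h x = v" using meet [OF i(1) j(1) False] by simp
      then show ?thesis using pre [OF i] pre [OF j] eq by simp
    qed
  qed
  define H where "H = \<lparr>verts = h ` verts F, edges = (\<lambda>f. h ` f) ` edges F\<rparr>"
  have edges_H: "edges H = insert e (es ` {..<?l})"
    using h_base h_edge by (auto simp: H_def F(1) image_iff)
  have "verts H = \<Union> (edges H)"
    by (auto simp: H_def F(2))
  moreover have "edges H \<subseteq> edges G" using edges_H e es by auto
  ultimately have "subgraph H G"
    using finG by (auto simp: subgraph_def)
  moreover have "isomorphic F H"
    unfolding isomorphic_def using inj by (intro exI [of _ h]) (auto simp: H_def bij_betw_def)
  ultimately show ?thesis by (auto simp: contains_copy_def)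
qed

section \<open>The complete partite lower bound\<close>

text \<open>
  The base takes every colour once, so some base vertex \<open>x\<close> has the colour of the apex.  The arms
  cover the base, so \<open>x\<close> and the apex lie in a common edge, although no edge repeats a colour.
\<close>

lemma partite_tent_free:
  fixes G :: "'b hypergraph" and c :: "'b \<Rightarrow> nat"
  assumes k: "k = sum_list lam" "k > 0" and tent: "is_tent lam F"
    and c: "\<And>x. c x < k"
    and G: "\<And>e. e \<in> edges G \<Longrightarrow> inj_on c e"
  shows "\<not> contains_copy G F"
proof
  let ?l = "length lam"
  assume "contains_copy G F"
  then obtain H where "subgraph H G" "isomorphic F H" by (auto simp: contains_copy_def)
  then obtain f where H: "edges H \<subseteq> edges G" "bij_betw f (verts F) (verts H)" "edges H = (\<lambda>e. f ` e) ` edges F"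
    by (auto simp: isomorphic_def subgraph_def)
  obtain b ds u where F: "edges F = insert b (ds ` {..<?l})" "verts F = \<Union> (edges F)" "u \<notin> b"
    and D: "\<forall>i<?l. u \<in> ds i \<and> card (ds i \<inter> b) = lam ! i"
      "\<forall>i<?l. \<forall>j<?l. i \<noteq> j \<longrightarrow> ds i \<inter> ds j = {u}"
    by (rule is_tentE [OF tent])
  note ds = D(1) [rule_format] and dmeet = D(2) [rule_format]
  have kF: "kgraph (sum_list lam) F" using tent by (simp add: is_tent_def)
  have inj: "inj_on (c \<circ> f) d" if "d \<in> edges F" for d
  proof (rule comp_inj_on)
    show "inj_on f d" using H(2) F(2) that by (auto simp: bij_betw_def intro: inj_on_subset)
    show "inj_on c (f ` d)" using H that by (intro G) auto
  qed
  have fb: "finite b" "card b = k" using kF F(1) k finite_subset by (auto simp: kgraph_def)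
  have b: "b = (\<Union>i<?l. ds i \<inter> b)"
    by (rule tent_base_eq_Union [OF _ _ F(3) _ dmeet]) (use fb k ds in simp_all)
  have "card ((c \<circ> f) ` b) = card {..<k}"
    using card_image [OF inj [of b]] F(1) fb(2) by simp
  then have "(c \<circ> f) ` b = {..<k}"
    by (intro card_subset_eq) (use c in auto)
  then have "c (f u) \<in> (c \<circ> f) ` b" using c [of "f u"] by simp
  then obtain x where x: "x \<in> b" "c (f x) = c (f u)" by (metis comp_apply imageE)
  then obtain i where i: "i < ?l" "x \<in> ds i" using b by blast
  have "inj_on (c \<circ> f) (ds i)" using inj [of "ds i"] F(1) i(1) by simp
  then have "x = u" by (rule inj_onD) (use i x ds in simp_all)
  then show False using F(3) x by simp
qed

definition mod_partite :: "nat \<Rightarrow> nat \<Rightarrow> nat hypergraph" where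
  "mod_partite k n = \<lparr>verts = {..<n}, edges = {e. e \<subseteq> {..<n} \<and> card e = k \<and> inj_on (\<lambda>x. x mod k) e}\<rparr>"

text \<open>
  Choosing a multiple \<open>\<phi> r * k\<close> for every residue \<open>r\<close> gives the edge \<open>{\<phi> r * k + r | r < k}\<close>, and
  the residues let one recover \<open>\<phi>\<close> from the edge.
\<close>

lemma card_edges_mod_partite:
  assumes "k > 0"
  shows "(n div k) ^ k \<le> card (edges (mod_partite k n))"
proof -
  let ?P = "\<Pi>\<^sub>E r\<in>{..<k}. {..<n div k}"
  let ?s = "\<lambda>\<phi>. (\<lambda>r. \<phi> r * k + r) ` {..<k}"
  have "inj_on ?s ?P"
  proof (rule inj_onI)
    fix \<phi> \<psi> assume P: "\<phi> \<in> ?P" "\<psi> \<in> ?P" and eq: "?s \<phi> = ?s \<psi>"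
    show "\<phi> = \<psi>"
    proof (rule PiE_ext [OF P])
      fix r assume r: "r \<in> {..<k}"
      then have "\<phi> r * k + r \<in> ?s \<psi>" using eq by blast
      then obtain s where s: "s < k" "\<phi> r * k + r = \<psi> s * k + s" by auto
      have "(\<phi> r * k + r) mod k = r" using r by simp
      moreover have "(\<psi> s * k + s) mod k = s" using s(1) by simp
      ultimately have "r = s" using s(2) by metis
      then show "\<phi> r = \<psi> r" using s(2) \<open>k > 0\<close> by simp
    qed
  qed
  moreover have "?s ` ?P \<subseteq> edges (mod_partite k n)"
  proof (rule image_subsetI)
    fix \<phi> assume P: "\<phi> \<in> ?P"
    have "\<phi> r * k + r < n" if "r < k" for r
    proof -
      have "\<phi> r < n div k" using P that by auto
      then have "(\<phi> r + 1) * k \<le> n div k * k" by (intro mult_le_mono1) simp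
      also have "\<dots> \<le> n" by simp
      finally show ?thesis using that by simp
    qed
    moreover have "inj_on (\<lambda>x. x mod k) (?s \<phi>)" by (auto intro!: inj_onI)
    moreover have "card (?s \<phi>) = k"
    proof -
      have "inj_on (\<lambda>r. \<phi> r * k + r) {..<k}"
        by (rule inj_on_inverseI [of _ "\<lambda>x. x mod k"]) simp
      then show ?thesis by (simp add: card_image)
    qed
    ultimately show "?s \<phi> \<in> edges (mod_partite k n)" by (auto simp: mod_partite_def)
  qed
  moreover have "finite (edges (mod_partite k n))" by (simp add: mod_partite_def)
  ultimately have "card ?P \<le> card (edges (mod_partite k n))" by (rule card_inj_on_le)
  then show ?thesis by (simp add: card_PiE)
qed

lemma mod_partite_host:
  assumes "k = sum_list lam" "k > 0" "is_tent lam F"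
  shows "kgraph k (mod_partite k n) \<and> card (verts (mod_partite k n)) = n \<and>
         \<not> contains_copy (mod_partite k n) F"
proof (intro conjI)
  show "\<not> contains_copy (mod_partite k n) F"
    by (rule partite_tent_free [OF assms, where c = "\<lambda>x. x mod k"])
      (use assms in \<open>auto simp: mod_partite_def\<close>)
qed (auto simp: kgraph_def mod_partite_def)

lemma finite_edge_counts:
  "finite {card (edges G) | G :: nat hypergraph. kgraph k G \<and> card (verts G) = n \<and> \<not> contains_copy G F}"
proof (rule finite_subset)
  show "{card (edges G) | G :: nat hypergraph. kgraph k G \<and> card (verts G) = n \<and> \<not> contains_copy G F} \<subseteq> {..2 ^ n}"
  proof
    fix m assume "m \<in> {card (edges G) | G :: nat hypergraph. kgraph k G \<and> card (verts G) = n \<and> \<not> contains_copy G F}"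
    then obtain G :: "nat hypergraph" where G: "kgraph k G" "card (verts G) = n" "m = card (edges G)"
      by blast
    then have "card (edges G) \<le> card (Pow (verts G))" by (intro card_mono) (auto simp: kgraph_def)
    then show "m \<in> {..2 ^ n}" using G by (simp add: card_Pow kgraph_def)
  qed
qed simp

lemma ex_turan_ge_tent:
  assumes "k = sum_list lam" "k > 0" "is_tent lam F"
  shows "(n div k) ^ k \<le> ex_turan k n F"
proof -
  have "card (edges (mod_partite k n)) \<le> ex_turan k n F"
    unfolding ex_turan_def using finite_edge_counts mod_partite_host [OF assms] by (intro Max_ge) blast+
  with card_edges_mod_partite [OF assms(2), of n] show ?thesis by simp
qed

lemma ex_turan_attained:
  assumes "k = sum_list lam" "k > 0" "is_tent lam F"
  obtains G :: "nat hypergraph" where "kgraph k G" "card (verts G) = n" "\<not> contains_copy G F"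
    "card (edges G) = ex_turan k n F"
proof -
  let ?X = "{card (edges G) | G :: nat hypergraph. kgraph k G \<and> card (verts G) = n \<and> \<not> contains_copy G F}"
  have "?X \<noteq> {}" using mod_partite_host [OF assms] by blast
  then have "ex_turan k n F \<in> ?X"
    unfolding ex_turan_def by (intro Max_in finite_edge_counts)
  then show ?thesis using that by auto
qed

section \<open>The Turan density\<close>

text \<open>
  After pruning, a forbidden configuration \<open>S\<close>, \<open>T\<close>, \<open>v\<close> as in \<open>card_uniform_le_if_no_cover\<close> would yield
  a tent with base \<open>S \<union> T\<close> and apex \<open>v\<close>: the large part is any subset of \<open>S\<close> of the right size, which
  exists because \<open>S\<close> is at least half of the edge.  The other parts are single vertices, and each of
  them lies in \<open>S\<close> or \<open>T\<close>, hence together with \<open>v\<close> in an edge.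
\<close>

lemma tent_free_card_edges_le:
  fixes G :: "'b hypergraph"
  assumes k: "k \<ge> 2" and part: "is_partition k lam"
    and half: "int (lam ! 0) \<le> \<lceil>real k / 2\<rceil>"
    and ones: "\<forall>i. 0 < i \<and> i < length lam \<longrightarrow> lam ! i = 1"
    and tent: "is_tent lam F"
    and G: "kgraph k G" and free: "\<not> contains_copy G F"
  shows "real (card (edges G)) \<le> (card (verts G) / k) ^ k + k ^ 3 * card (verts G) ^ (k - 1)"
proof -
  let ?l = "length lam"
  have l: "?l \<ge> 2" using tent by (simp add: is_tent_def)
  have sum: "sum_list lam = k" using part by (simp add: is_partition_def)
  have k_eq: "k = lam ! 0 + (?l - 1)"
  proof -
    have "k = (\<Sum>i<?l. lam ! i)" using sum by (simp add: sum_list_sum_nth atLeast0LessThan)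
    also have "{..<?l} = insert 0 {1..<?l}" using l by auto
    also have "(\<Sum>i\<in>\<dots>. lam ! i) = lam ! 0 + (\<Sum>i\<in>{1..<?l}. 1)"
      using ones by simp
    finally show ?thesis by simp
  qed
  have "lam ! 0 \<in> set lam" using l by (intro nth_mem) auto
  then have "0 < lam ! 0" using part by (simp add: is_partition_def)
  then have lk: "?l * k \<le> k * k" using k_eq by simp
  have finV: "finite (verts G)" and E: "\<And>e. e \<in> edges G \<Longrightarrow> e \<subseteq> verts G \<and> card e = k"
    using G by (auto simp: kgraph_def)
  \<comment> \<open>There are at most \<open>k\<close> arms, so attaching them requires avoiding at most \<open>k * k\<close> vertices.\<close>
  obtain E' where sub: "E' \<subseteq> edges G" and flex: "flexible (k * k) E'"
    and loss: "card (edges G) \<le> card E' + k * (k * k) * card (verts G) ^ (k - 1)"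
    using exists_flexible_subset [OF finV E] by blast
  have E': "e \<subseteq> verts G \<and> card e = k" if "e \<in> E'" for e using that sub E by blast
  have fine: "finite e \<and> card e = k" if "e \<in> E'" for e
    using E' [OF that] finV finite_subset by auto
  have "real (card E') \<le> (card (verts G) / k) ^ k"
  proof (rule card_uniform_le_if_no_cover [OF _ finV E'])
    fix S T v
    assume e: "S \<union> T \<in> E'" "v \<notin> S \<union> T" and S: "k \<le> 2 * card S" "\<exists>f\<in>E'. insert v S \<subseteq> f"
      and T: "\<exists>f\<in>E'. insert v T \<subseteq> f"
    have "\<lceil>real k / 2\<rceil> \<le> int (card S)" using S(1) by (simp add: ceiling_le_iff)
    then have "lam ! 0 \<le> card S" using half by linarith
    \<comment> \<open>\<open>A0\<close> is the large part; \<open>u\<close> enumerates the remaining base vertices as singleton parts.\<close>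
    then obtain A0 where A0: "A0 \<subseteq> S" "card A0 = lam ! 0"
      using obtain_subset_with_card_n by metis
    have fe: "finite (S \<union> T)" "card (S \<union> T) = k" using fine [OF e(1)] by auto
    have "finite A0" using A0 fe finite_subset by auto
    then have "card (S \<union> T - A0) = card {1..<?l}"
      using A0 fe k_eq by (subst card_Diff_subset) auto
    then obtain u where u: "bij_betw u {1..<?l} (S \<union> T - A0)"
      using fe by (metis finite_Diff finite_atLeastLessThan finite_same_card_bij)
    define A where "A i = (if i = 0 then A0 else {u i})" for i
    have uE: "u i \<in> S \<union> T - A0" if "0 < i" "i < ?l" for i
      using u that by (auto simp: bij_betw_def)
    have "\<exists>es. \<forall>i<?l. es i \<in> E' \<and> v \<in> es i \<and> es i \<inter> (S \<union> T) = A i \<and> (\<forall>j<i. es i \<inter> es j = {v})"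
    proof (rule flexible_attach_edges [OF flex fine e])
      show "A i \<subseteq> S \<union> T \<and> (\<exists>f\<in>E'. insert v (A i) \<subseteq> f)" if "i < ?l" for i
      proof (cases "i = 0")
        case True
        then show ?thesis using A0 S(2) by (auto simp: A_def)
      next
        case False
        then have "u i \<in> S \<union> T" using uE that by blast
        then show ?thesis using S(2) T False by (auto simp: A_def)
      qed
      show "A i \<inter> A j = {}" if "i < ?l" "j < ?l" "i \<noteq> j" for i j
      proof -
        have "u i \<noteq> u j" if "0 < i" "0 < j"
          using u that \<open>i < ?l\<close> \<open>j < ?l\<close> \<open>i \<noteq> j\<close> by (auto simp: bij_betw_def dest: inj_onD)
        then show ?thesis using uE [of i] uE [of j] that by (auto simp: A_def)
      qed
    qed (use lk in auto)
    then obtain es where es: "\<And>i. i < ?l \<Longrightarrow> es i \<in> E' \<and> v \<in> es i \<and> es i \<inter> (S \<union> T) = A i"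
      and less: "\<And>i j. i < ?l \<Longrightarrow> j < i \<Longrightarrow> es i \<inter> es j = {v}"
      by blast
    have "contains_copy G F"
    proof (rule contains_copy_tentI [OF tent, of G "S \<union> T" v es])
      show "es i \<in> edges G \<and> v \<in> es i \<and> card (es i \<inter> (S \<union> T)) = lam ! i" if "i < ?l" for i
        using es [OF that] sub A0 ones that by (auto simp: A_def)
      show "es i \<inter> es j = {v}" if "i < ?l" "j < ?l" "i \<noteq> j" for i j
        using less [of i j] less [of j i] that by (cases "i < j") (auto simp: Int_commute)
    qed (use G sum e sub in auto)
    then show False using free by contradiction
  qed (use k in auto)
  moreover have "real (card (edges G)) \<le> real (card E' + k * (k * k) * card (verts G) ^ (k - 1))"
    using loss of_nat_le_iff by blast
  ultimately show ?thesis by (simp add: power3_eq_cube)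
qed

lemma binomial_div_power_tendsto:
  "(\<lambda>n. real (n choose k) / real n ^ k) \<longlonglongrightarrow> 1 / fact k"
proof (induction k)
  case (Suc k)
  have "(\<lambda>n. real (n choose k) / real n ^ k * ((1 - real k * (1 / real n)) / real (Suc k)))
        \<longlonglongrightarrow> 1 / fact k * ((1 - real k * 0) / real (Suc k))"
    by (intro tendsto_intros Suc lim_1_over_n) simp
  moreover have "\<forall>\<^sub>F n in sequentially. real (n choose k) / real n ^ k * ((1 - real k * (1 / real n)) / real (Suc k))
      = real (n choose Suc k) / real n ^ Suc k"
    using eventually_gt_at_top [of 0]
  proof eventually_elim
    case (elim n)
    have "real n * real (n choose k) = real k * real (n choose k) + real (Suc k) * real (n choose Suc k)"
      using gbinomial_mult_1 [of "real n" k] by (simp add: binomial_gbinomial)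
    then have "real (n choose Suc k) = (real n - real k) * real (n choose k) / real (Suc k)"
      by (simp add: field_simps)
    moreover have "1 - real k * (1 / real n) = (real n - real k) / real n"
      using elim by (simp add: field_simps)
    ultimately show ?case by (simp add: mult_ac del: of_nat_Suc)
  qed
  ultimately show ?case by (auto dest: Lim_transform_eventually simp: mult.commute)
qed simp

lemma div_over_self_tendsto:
  assumes "k > 0"
  shows "(\<lambda>n. real (n div k) / real n) \<longlonglongrightarrow> 1 / real k"
proof (rule tendsto_sandwich)
  have bounds: "real n / real k - 1 \<le> real (n div k)" "real (n div k) \<le> real n / real k" for n
  proof -
    have "real n = real k * real (n div k) + real (n mod k)"
      by (metis mult_div_mod_eq of_nat_add of_nat_mult)
    moreover have "real (n mod k) \<le> real k" using assms by (simp add: less_imp_le)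
    ultimately show "real n / real k - 1 \<le> real (n div k)" "real (n div k) \<le> real n / real k"
      using assms by (simp_all add: field_simps)
  qed
  show "\<forall>\<^sub>F n in sequentially. 1 / real k - 1 / real n \<le> real (n div k) / real n"
    using eventually_gt_at_top [of 0]
  proof eventually_elim
    case (elim n)
    then show ?case using divide_right_mono [OF bounds(1) [of n], of "real n"]
      by (simp add: diff_divide_distrib)
  qed
  show "\<forall>\<^sub>F n in sequentially. real (n div k) / real n \<le> 1 / real k"
    using eventually_gt_at_top [of 0]
  proof eventually_elim
    case (elim n)
    then show ?case using divide_right_mono [OF bounds(2) [of n], of "real n"] by simp
  qed
  show "(\<lambda>n. 1 / real k - 1 / real n) \<longlonglongrightarrow> 1 / real k"
    using tendsto_diff [OF tendsto_const lim_1_over_n, of "1 / real k"] by simp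
qed simp

theorem theorem1p7:
  fixes k :: nat and lam :: "nat list" and F :: "'a hypergraph"
  assumes "k \<ge> 2"
    and "is_partition k lam"
    and "int (lam ! 0) \<le> \<lceil>real k / 2\<rceil>"
    and "\<forall>i. 0 < i \<and> i < length lam \<longrightarrow> lam ! i = 1"
    and "is_tent lam F"
  shows "turan_density k F = fact k / real k ^ k"
proof -
  have k: "k = sum_list lam" "k > 0" using assms by (auto simp: is_partition_def)
  let ?r = "\<lambda>n. real (n choose k) / real n ^ k"
  have "(\<lambda>n. real (ex_turan k n F) / real (n choose k)) \<longlonglongrightarrow> fact k / real k ^ k"
  proof (rule tendsto_sandwich)
    show "(\<lambda>n. (real (n div k) / real n) ^ k / ?r n) \<longlonglongrightarrow> fact k / real k ^ k"
      using tendsto_divide [OF tendsto_power [OF div_over_self_tendsto [OF k(2)], of k] binomial_div_power_tendsto [of k]]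
      by (simp add: power_divide)
    have "(\<lambda>n. ((1 / real k) ^ k + real (k ^ 3) * (1 / real n)) / ?r n)
        \<longlonglongrightarrow> ((1 / real k) ^ k + real (k ^ 3) * 0) / (1 / fact k)"
      by (intro tendsto_intros lim_1_over_n binomial_div_power_tendsto) simp
    then show "(\<lambda>n. ((1 / real k) ^ k + real (k ^ 3) * (1 / real n)) / ?r n) \<longlonglongrightarrow> fact k / real k ^ k"
      by (simp add: power_divide)
    show "\<forall>\<^sub>F n in sequentially. (real (n div k) / real n) ^ k / ?r n \<le> real (ex_turan k n F) / real (n choose k)"
      using eventually_gt_at_top [of 0]
    proof eventually_elim
      case (elim n)
      have "real (n div k) ^ k \<le> real (ex_turan k n F)"
        using ex_turan_ge_tent [OF k assms(5), of n] by (metis of_nat_le_iff of_nat_power)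
      then have "real (n div k) ^ k / real (n choose k) \<le> real (ex_turan k n F) / real (n choose k)"
        by (rule divide_right_mono) simp
      then show ?case using elim by (simp add: power_divide)
    qed
    show "\<forall>\<^sub>F n in sequentially. real (ex_turan k n F) / real (n choose k)
        \<le> ((1 / real k) ^ k + real (k ^ 3) * (1 / real n)) / ?r n"
      using eventually_gt_at_top [of 0]
    proof eventually_elim
      case (elim n)
      obtain G :: "nat hypergraph" where G: "kgraph k G" "card (verts G) = n" "\<not> contains_copy G F"
        "card (edges G) = ex_turan k n F"
        by (rule ex_turan_attained [OF k assms(5)])
      have "real (ex_turan k n F) \<le> (real n / real k) ^ k + real k ^ 3 * real n ^ (k - 1)"
        using tent_free_card_edges_le [OF assms G(1,3)] G by simp
      also have "real n ^ (k - 1) = real n ^ k * (1 / real n)"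
        using elim k(2) by (simp add: power_eq_if)
      finally have "real (ex_turan k n F) \<le> ((1 / real k) ^ k + real (k ^ 3) * (1 / real n)) * real n ^ k"
        by (simp add: power_divide algebra_simps)
      then have "real (ex_turan k n F) / real (n choose k)
          \<le> ((1 / real k) ^ k + real (k ^ 3) * (1 / real n)) * real n ^ k / real (n choose k)"
        by (rule divide_right_mono) simp
      then show ?case by simp
    qed
  qed
  then show ?thesis unfolding turan_density_def by (rule limI)
qed

end
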